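(* Let $G=\sum_{k\in\Lambda,\,\sigma=\uparrow,\downarrow}C_{k\sigma}^*C_{k\sigma}$ and let $H$ be the BCS Hamiltonian. Then, for all $\alpha\in\mathbb{R}$, $k\in\Lambda$ and $\sigma\in\{\uparrow,\downarrow\}$, $$e^{-i\alpha G}C_{k\sigma}e^{i\alpha G}=e^{i\alpha}C_{k\sigma},\qquad e^{-i\alpha G}C_{k\sigma}^*e^{i\alpha G}=e^{-i\alpha}C_{k\sigma}^*.$$ Consequently, $e^{-i\alpha G}He^{i\alpha G}=H$.
   Context: Fix (large) real numbers $L,K_{max}>0$ and let $\Lambda=\{\frac{2\pi}{L}(n_1,n_2,n_3)\in\mathbb{R}^3: n_1,n_2,n_3\in\mathbb{Z},\ \frac{2\pi}{L}\sqrt{n_1^2+n_2^2+n_3^2}\le K_{max}\}$, a finite set with $M$ elements, whose elements are arranged in a fixed order. Let $\mathcal{H}=\mathbb{C}^{2^{2M}}$ with its standard inner product $(\cdot,\cdot)$; its standard unit vectors are labelled $|n_{k\uparrow},n_{k\downarrow},n_{k'\uparrow},n_{k'\downarrow},\ldots\rangle$ with $n_{k\sigma}\in\{0,1\}$, $k\in\Lambda$, $\sigma\in\{\uparrow,\downarrow\}$. The annihilation operator $C_{k\sigma}$ is the linear operator on $\mathcal{H}$ which sends a standard unit vector with $n_{k\sigma}=1$ to $(-1)^{s}$ times the standard unit vector obtained by replacing $n_{k\sigma}$ by $0$, where $s$ is the sum of the occupation numbers to the left of $n_{k\sigma}$, and sends a standard unit vector with $n_{k\sigma}=0$ to $0$.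 The creation operator $C_{k\sigma}^*$ sends a standard unit vector with $n_{k\sigma}=0$ to $(-1)^{s}$ times the one with $n_{k\sigma}$ replaced by $1$ (same $s$), and one with $n_{k\sigma}=1$ to $0$; it is the adjoint of $C_{k\sigma}$. Let $m,\mu,\hbar>0$ and $\xi_k=\hbar^2|k|^2/(2m)-\mu$. Let $U_{k,k'}$ ($k,k'\in\Lambda$) be real with $U_{k,k'}\le 0$, $U_{k',k}=U_{k,k'}$, $U_{-k,-k'}=U_{k,k'}$, $U_{k,k}=0$. The BCS Hamiltonian is $$H=\sum_{k\in\Lambda,\,\sigma=\uparrow,\downarrow}\xi_kC_{k\sigma}^*C_{k\sigma}+\sum_{k,k'\in\Lambda}U_{k,k'}C_{k'\uparrow}^*C_{-k'\downarrow}^*C_{-k\downarrow}C_{k\uparrow}.$$ *)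

theory Defs
  imports "HOL-Analysis.Analysis" "Jordan_Normal_Form.Jordan_Normal_Form"
    "Jordan_Normal_Form.Schur_Decomposition"
begin

definition momenta :: "real \<Rightarrow> real \<Rightarrow> (real ^ 3) set" where
  "momenta L Kmax =
     {(2 * pi / L) *\<^sub>R vector [real_of_int n1, real_of_int n2, real_of_int n3] | n1 n2 n3.
        2 * pi / L * sqrt ((real_of_int n1)\<^sup>2 + (real_of_int n2)\<^sup>2 + (real_of_int n3)\<^sup>2) \<le> Kmax}"

datatype spin = Up | Down

text \<open>
  The fixed arrangement of the momenta is a list \<open>ks\<close> without repetitions, of length \<open>M\<close>.
  The Hilbert space is the space of complex vectors of dimension \<open>2 ^ (2 * M)\<close>, and linear
  operators on it are square matrices of this dimension. The standard unit vector number \<open>b\<close>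
  carries the label whose occupation numbers, read from left to right, are the binary digits
  of \<open>b\<close> starting from the least significant one; the occupation number of mode \<open>(k, \<sigma>)\<close> is
  the digit at position \<open>mode_pos ks k \<sigma>\<close>, so that the order is \<open>k\<up>, k\<down>, k'\<up>, k'\<down>, \<dots>\<close>.
\<close>

definition fock_dim :: "(real ^ 3) list \<Rightarrow> nat" where
  "fock_dim ks = 2 ^ (2 * length ks)"

definition mode_pos :: "(real ^ 3) list \<Rightarrow> real ^ 3 \<Rightarrow> spin \<Rightarrow> nat" where
  "mode_pos ks k \<sigma> =
     2 * length (takeWhile (\<lambda>q. q \<noteq> k) ks) + (case \<sigma> of Up \<Rightarrow> 0 | Down \<Rightarrow> 1)"

definition left_occupation :: "nat \<Rightarrow> nat \<Rightarrow> nat" where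
  "left_occupation p b = (\<Sum>q<p. of_bool (bit b q))"

text \<open>Column \<open>b\<close> of each of these matrices is the image of the standard unit vector number \<open>b\<close>.\<close>

definition annihilation :: "(real ^ 3) list \<Rightarrow> real ^ 3 \<Rightarrow> spin \<Rightarrow> complex mat" where
  "annihilation ks k \<sigma> = (let N = fock_dim ks; p = mode_pos ks k \<sigma> in
     mat_of_cols N (map (\<lambda>b.
       if bit b p then (-1) ^ left_occupation p b \<cdot>\<^sub>v unit_vec N (unset_bit p b) else 0\<^sub>v N)
     [0..<N]))"

definition creation :: "(real ^ 3) list \<Rightarrow> real ^ 3 \<Rightarrow> spin \<Rightarrow> complex mat" where
  "creation ks k \<sigma> = (let N = fock_dim ks; p = mode_pos ks k \<sigma> in
     mat_of_cols N (map (\<lambda>b.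
       if bit b p then 0\<^sub>v N else (-1) ^ left_occupation p b \<cdot>\<^sub>v unit_vec N (set_bit p b))
     [0..<N]))"

definition op_sum :: "nat \<Rightarrow> ('i \<Rightarrow> complex mat) \<Rightarrow> 'i set \<Rightarrow> complex mat" where
  "op_sum N f I = finsum (module_mat TYPE(complex) N N) f I"

text \<open>The exponential series of a square matrix; it converges entrywise.\<close>

definition exp_mat :: "complex mat \<Rightarrow> complex mat" where
  "exp_mat A = Matrix.mat (dim_row A) (dim_row A)
     (\<lambda>(i, j). \<Sum>n. (A ^\<^sub>m n) $$ (i, j) / fact n)"

definition number_op :: "(real ^ 3) list \<Rightarrow> complex mat" where
  "number_op ks = op_sum (fock_dim ks)
     (\<lambda>(k, \<sigma>). creation ks k \<sigma> * annihilation ks k \<sigma>) (set ks \<times> {Up, Down})"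

definition xi :: "real \<Rightarrow> real \<Rightarrow> real \<Rightarrow> real ^ 3 \<Rightarrow> real" where
  "xi hbar m \<mu> k = hbar\<^sup>2 * (norm k)\<^sup>2 / (2 * m) - \<mu>"

definition bcs_hamiltonian ::
  "(real ^ 3) list \<Rightarrow> real \<Rightarrow> real \<Rightarrow> real \<Rightarrow> (real ^ 3 \<Rightarrow> real ^ 3 \<Rightarrow> real) \<Rightarrow> complex mat" where
  "bcs_hamiltonian ks hbar m \<mu> U =
     op_sum (fock_dim ks)
       (\<lambda>(k, \<sigma>). complex_of_real (xi hbar m \<mu> k) \<cdot>\<^sub>m (creation ks k \<sigma> * annihilation ks k \<sigma>))
       (set ks \<times> {Up, Down})
   + op_sum (fock_dim ks)
       (\<lambda>(k, k'). complex_of_real (U k k') \<cdot>\<^sub>m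
          (creation ks k' Up * creation ks (- k') Down
           * annihilation ks (- k) Down * annihilation ks k Up))
       (set ks \<times> set ks)"

lemma finite_momenta:
  assumes "L > 0"
  shows "finite (momenta L Kmax)"
proof -
  define B where "B = \<lfloor>Kmax * L / (2 * pi)\<rfloor>"
  have bnd: "x \<in> {-B..B}"
    if "2 * pi / L * sqrt s \<le> Kmax" "(real_of_int x)\<^sup>2 \<le> s" for x s
  proof -
    have "\<bar>real_of_int x\<bar> \<le> sqrt s"
      using that(2) by (metis real_sqrt_abs real_sqrt_le_iff)
    also have "sqrt s \<le> Kmax * L / (2 * pi)"
      using that(1) assms by (simp add: field_simps)
    finally have "real_of_int \<bar>x\<bar> \<le> Kmax * L / (2 * pi)" by simp
    then have "\<bar>x\<bar> \<le> B" unfolding B_def by (simp add: le_floor_iff)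
    then show ?thesis by auto
  qed
  have "momenta L Kmax \<subseteq> (\<lambda>(n1, n2, n3). (2 * pi / L) *\<^sub>R
      vector [real_of_int n1, real_of_int n2, real_of_int n3]) ` ({-B..B} \<times> {-B..B} \<times> {-B..B})"
    unfolding momenta_def
  proof (clarify, goal_cases)
    case (1 x n1 n2 n3)
    have "n1 \<in> {-B..B}" "n2 \<in> {-B..B}" "n3 \<in> {-B..B}"
      using bnd[OF 1] by simp_all
    then show ?case by (intro image_eqI[where x = "(n1, n2, n3)"]) auto
  qed
  then show ?thesis by (rule finite_subset) auto
qed

lemma mode_pos_less:
  assumes "k \<in> set ks"
  shows "mode_pos ks k \<sigma> < 2 * length ks"
proof -
  have "length (takeWhile (\<lambda>q. q \<noteq> k) ks) < length ks"
    using assms by (metis (mono_tags, lifting) length_takeWhile_le nat_less_le takeWhile_eq_all_conv takeWhile_eq_take take_all_iff le_refl)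
  then show ?thesis by (auto simp: mode_pos_def split: spin.splits)
qed

lemma creation_adjoint:
  assumes "k \<in> set ks"
  shows "creation ks k \<sigma> = mat_adjoint (annihilation ks k \<sigma>)"
proof -
  define N where "N = fock_dim ks"
  define p where "p = mode_pos ks k \<sigma>"
  have p: "p < 2 * length ks" using mode_pos_less[OF assms] by (simp add: p_def)
  have set_lt: "set_bit p b < N" if "b < N" for b
    using that p unfolding N_def fock_dim_def
    by (metis take_bit_nat_eq_self_iff take_bit_set_bit_eq not_le)
  have unset_lt: "unset_bit p b < N" if "b < N" for b
    using that p unfolding N_def fock_dim_def
    by (metis take_bit_nat_eq_self_iff take_bit_unset_bit_eq not_le)
  have eq: "(\<not> bit j p \<and> i = set_bit p j) \<longleftrightarrow> (bit i p \<and> j = unset_bit p i)" for i j :: nat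
  proof
    assume "\<not> bit j p \<and> i = set_bit p j"
    then show "bit i p \<and> j = unset_bit p i"
      by (auto intro!: bit_eqI simp: bit_simps)
  next
    assume "bit i p \<and> j = unset_bit p i"
    then show "\<not> bit j p \<and> i = set_bit p j"
      by (auto intro!: bit_eqI simp: bit_simps)
  qed
  have occ: "left_occupation p (unset_bit p i) = left_occupation p i" for i
    unfolding left_occupation_def by (intro sum.cong) (auto simp: bit_simps)
  have c: "creation ks k \<sigma> $$ (i, j) =
      (if \<not> bit j p \<and> i = set_bit p j then (-1) ^ left_occupation p j else 0)"
    if "i < N" "j < N" for i j
    using that set_lt[of j] by (auto simp: creation_def Let_def N_def[symmetric] p_def[symmetric] mat_of_cols_index)
  have a: "annihilation ks k \<sigma> $$ (i, j) =
      (if bit j p \<and> i = unset_bit p j then (-1) ^ left_occupation p j else 0)"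
    if "i < N" "j < N" for i j
    using that unset_lt[of j] by (auto simp: annihilation_def Let_def N_def[symmetric] p_def[symmetric] mat_of_cols_index)
  have da: "annihilation ks k \<sigma> \<in> carrier_mat N N"
    by (auto simp: annihilation_def Let_def N_def)
  have dc: "creation ks k \<sigma> \<in> carrier_mat N N"
    by (auto simp: creation_def Let_def N_def)
  show ?thesis
  proof (rule eq_matI)
    fix i j assume "i < dim_row (mat_adjoint (annihilation ks k \<sigma>))"
      "j < dim_col (mat_adjoint (annihilation ks k \<sigma>))"
    then have ij: "i < N" "j < N" using da by (auto simp: mat_adjoint_def)
    have "mat_adjoint (annihilation ks k \<sigma>) $$ (i, j) = cnj (annihilation ks k \<sigma> $$ (j, i))"
      using ij da by (auto simp: mat_adjoint_def mat_of_rows_index)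
    then show "creation ks k \<sigma> $$ (i, j) = mat_adjoint (annihilation ks k \<sigma>) $$ (i, j)"
      using ij eq[of j i] occ[of i] by (auto simp: a c)
  qed (use da dc in \<open>auto simp: mat_adjoint_def\<close>)
qed

lemma exp_mat_summable:
  fixes A :: "complex mat"
  assumes A: "A \<in> carrier_mat N N" and "i < N" "j < N"
  shows "summable (\<lambda>n. (A ^\<^sub>m n) $$ (i, j) / fact n)"
proof -
  obtain b where b: "norm_bound A b" using norm_bound_max by blast
  have "b \<ge> 0" using b A assms(2) unfolding norm_bound_def
    by (metis carrier_matD norm_ge_zero order_trans)
  have nb: "norm_bound (A ^\<^sub>m n) ((b * N) ^ n)" for n
  proof (induction n)
    case 0
    then show ?case using A by (auto simp: norm_bound_def)
  next
    case (Suc n)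
    have "norm_bound (A ^\<^sub>m n * A) ((b * N) ^ n * b * of_nat N)"
      by (rule norm_bound_mult[OF _ A Suc b]) (use A in auto)
    then show ?case by (simp add: mult_ac)
  qed
  have "summable (\<lambda>n. (b * N) ^ n / fact n)"
    using summable_exp[of "b * N"] by (simp add: field_simps)
  then show ?thesis
  proof (rule summable_comparison_test'[where N = 0])
    fix n
    have "norm ((A ^\<^sub>m n) $$ (i, j)) \<le> (b * N) ^ n"
      using nb[of n] assms unfolding norm_bound_def by auto
    then show "norm ((A ^\<^sub>m n) $$ (i, j) / fact n) \<le> (b * N) ^ n / fact n"
      by (simp add: norm_divide divide_right_mono)
  qed
qed

end

theory Submission
  imports Defs
begin

text \<open>
  In the occupation number basis \<open>G\<close> is diagonal, its eigenvalue at a basis vector being the number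
  \<open>\<nu>\<close> of occupied modes. Call an operator homogeneous of degree \<open>q\<close> if it only connects basis
  vectors whose values of \<open>\<nu>\<close> differ by \<open>q\<close>. Conjugation by \<open>exp (-\<i>\<alpha>G)\<close> multiplies such an
  operator by \<open>exp (-\<i>\<alpha>q)\<close>. Annihilation has degree \<open>-1\<close>, creation has degree \<open>1\<close>, and degrees add
  under multiplication, so that \<open>H\<close> has degree \<open>0\<close>.
\<close>

section \<open>Homogeneous operators and their closure properties\<close>

definition homogeneous :: "nat \<Rightarrow> (nat \<Rightarrow> nat) \<Rightarrow> int \<Rightarrow> complex mat \<Rightarrow> bool" where
  "homogeneous N \<nu> q X \<longleftrightarrow> X \<in> carrier_mat N N \<and>
     (\<forall>i<N. \<forall>j<N. X $$ (i, j) \<noteq> 0 \<longrightarrow> int (\<nu> i) = int (\<nu> j) + q)"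

lemma homogeneous_carrier: "homogeneous N \<nu> q X \<Longrightarrow> X \<in> carrier_mat N N"
  by (simp add: homogeneous_def)

text \<open>A nonzero entry of the product needs a nonzero term
  \<open>X $$ (i, l) * Y $$ (l, j)\<close>; passing through the intermediate basis vector
  \<open>l\<close> adds the two jumps of \<open>\<nu>\<close>.\<close>

lemma homogeneous_mult:
  assumes "homogeneous N \<nu> q X" and "homogeneous N \<nu> r Y"
  shows "homogeneous N \<nu> (q + r) (X * Y)"
  unfolding homogeneous_def
proof (intro conjI allI impI)
  have X: "X \<in> carrier_mat N N" and Y: "Y \<in> carrier_mat N N"
    using assms by (simp_all add: homogeneous_def)
  then show "X * Y \<in> carrier_mat N N" by simp
  fix i j assume ij: "i < N" "j < N" and "(X * Y) $$ (i, j) \<noteq> 0"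
  then have "(\<Sum>l<N. X $$ (i, l) * Y $$ (l, j)) \<noteq> 0"
    using X Y by (simp add: scalar_prod_def atLeast0LessThan)
  then obtain l where "l < N" "X $$ (i, l) * Y $$ (l, j) \<noteq> 0"
    by (meson lessThan_iff sum.neutral)
  then show "int (\<nu> i) = int (\<nu> j) + (q + r)"
    using assms ij by (auto simp: homogeneous_def)
qed

lemma homogeneous_add:
  "homogeneous N \<nu> q X \<Longrightarrow> homogeneous N \<nu> q Y \<Longrightarrow> homogeneous N \<nu> q (X + Y)"
  unfolding homogeneous_def by auto (metis add.right_neutral)

lemma homogeneous_smult: "homogeneous N \<nu> q X \<Longrightarrow> homogeneous N \<nu> q (c \<cdot>\<^sub>m X)"
  by (auto simp: homogeneous_def)

section \<open>Finite sums of operators\<close>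

lemma op_sum_empty: "op_sum N f {} = 0\<^sub>m N N"
proof -
  interpret abelian_group "module_mat TYPE(complex) N N" by (rule abelian_group_mat)
  show ?thesis by (simp add: op_sum_def module_mat_simps)
qed

text \<open>The insertion rule of \<open>finsum\<close> asks for summands in the carrier of the
  matrix module, hence the dimension hypothesis. Inductions over index sets can then use ordinary
  matrix addition.\<close>

lemma op_sum_insert:
  assumes "finite I" and "x \<notin> I" and "\<And>y. y \<in> insert x I \<Longrightarrow> f y \<in> carrier_mat N N"
  shows "op_sum N f (insert x I) = f x + op_sum N f I"
proof -
  interpret abelian_group "module_mat TYPE(complex) N N" by (rule abelian_group_mat)
  have "finsum (module_mat TYPE(complex) N N) f (insert x I)
      = f x \<oplus>\<^bsub>module_mat TYPE(complex) N N\<^esub> finsum (module_mat TYPE(complex) N N) f I"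
    by (rule finsum_insert) (use assms in \<open>auto simp: module_mat_simps\<close>)
  then show ?thesis by (simp add: op_sum_def module_mat_simps)
qed

lemma homogeneous_op_sum:
  assumes "finite I" and "\<And>x. x \<in> I \<Longrightarrow> homogeneous N \<nu> q (f x)"
  shows "homogeneous N \<nu> q (op_sum N f I)"
  using assms
proof (induction I rule: finite_induct)
  case empty
  then show ?case by (simp add: op_sum_empty homogeneous_def)
next
  case (insert x I)
  then have "op_sum N f (insert x I) = f x + op_sum N f I"
    by (intro op_sum_insert) (auto dest: homogeneous_carrier)
  with insert show ?case by (auto intro: homogeneous_add)
qed

lemma op_sum_mat_diag:
  assumes "finite I" and "\<And>x. x \<in> I \<Longrightarrow> f x = mat_diag N (g x)"
  shows "op_sum N f I = mat_diag N (\<lambda>b. \<Sum>x\<in>I. g x b)"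
  using assms
proof (induction I rule: finite_induct)
  case empty
  then show ?case by (auto simp: op_sum_empty mat_diag_def)
next
  case (insert x I)
  then have "op_sum N f (insert x I) = f x + op_sum N f I"
    by (intro op_sum_insert) auto
  with insert show ?case by (auto simp: mat_diag_def)
qed

section \<open>Diagonal matrices, their exponentials and conjugation by them\<close>

lemma smult_mat_diag: "c \<cdot>\<^sub>m mat_diag N d = mat_diag N (\<lambda>i. c * d i)"
  for c :: "'a::semiring_0"
  by (auto simp: mat_diag_def)

lemma pow_mat_diag: "mat_diag N d ^\<^sub>m n = mat_diag N (\<lambda>i. d i ^ n)"
  for d :: "nat \<Rightarrow> 'a::semiring_1"
proof (induction n)
  case 0
  \<comment> \<open>The zeroth power is the identity matrix of size \<open>dim_row\<close>, so this
    size has to be computed.\<close>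
  have "dim_row (mat_diag N d) = N" by (simp add: mat_diag_def)
  then show ?case by simp
next
  case (Suc n)
  then show ?case by (simp add: power_commutes)
qed

text \<open>All powers are diagonal, so the series vanishes off the diagonal and is the scalar
  exponential series on it.\<close>

lemma exp_mat_diag: "exp_mat (mat_diag N d) = mat_diag N (\<lambda>i. exp (d i))"
proof (rule eq_matI)
  fix i j assume "i < dim_row (mat_diag N (\<lambda>i. exp (d i)))"
    "j < dim_col (mat_diag N (\<lambda>i. exp (d i)))"
  then have ij: "i < N" "j < N" by (simp_all add: mat_diag_def)
  have "(\<Sum>n. d j ^ n / fact n) = exp (d j)"
    by (simp add: exp_def scaleR_conv_of_real field_simps)
  then show "exp_mat (mat_diag N d) $$ (i, j) = mat_diag N (\<lambda>i. exp (d i)) $$ (i, j)"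
    using ij by (simp add: exp_mat_def pow_mat_diag) (simp add: mat_diag_def)
qed (simp_all add: exp_mat_def mat_diag_def)

text \<open>Both exponentials are diagonal, so entry \<open>(i, j)\<close> is multiplied by the
  exponential of \<open>-\<i> * \<alpha> * (\<nu> i - \<nu> j)\<close>. Wherever the entry is
  nonzero, the difference is \<open>q\<close>, and the factor no longer depends on \<open>i\<close>
  and \<open>j\<close>.\<close>

lemma homogeneous_conjugation:
  assumes "homogeneous N \<nu> q X"
  shows "exp_mat ((- \<i> * complex_of_real \<alpha>) \<cdot>\<^sub>m mat_diag N (\<lambda>b. of_nat (\<nu> b))) * X
      * exp_mat ((\<i> * complex_of_real \<alpha>) \<cdot>\<^sub>m mat_diag N (\<lambda>b. of_nat (\<nu> b)))
    = exp (- \<i> * complex_of_real \<alpha> * of_int q) \<cdot>\<^sub>m X" (is "?L = ?R")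
proof -
  have X: "X \<in> carrier_mat N N" using assms by (rule homogeneous_carrier)
  have L: "?L = Matrix.mat N N (\<lambda>(i, j). exp (- \<i> * complex_of_real \<alpha> * of_nat (\<nu> i)) * X $$ (i, j)
      * exp (\<i> * complex_of_real \<alpha> * of_nat (\<nu> j)))"
    unfolding smult_mat_diag exp_mat_diag
    by (subst mat_diag_mult_left[OF X], subst mat_diag_mult_right[of _ N]) auto
  show ?thesis
  proof (rule eq_matI)
    fix i j assume "i < dim_row ?R" "j < dim_col ?R"
    then have ij: "i < N" "j < N" using X by auto
    show "?L $$ (i, j) = ?R $$ (i, j)"
    proof (cases "X $$ (i, j) = 0")
      case True
      then show ?thesis unfolding L using X ij by simp
    next
      case False
      then have "int (\<nu> i) = int (\<nu> j) + q" using assms ij by (simp add: homogeneous_def)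
      then have "(of_nat (\<nu> i) :: complex) = of_nat (\<nu> j) + of_int q"
        by (metis of_int_add of_int_of_nat_eq)
      then have "exp (- \<i> * complex_of_real \<alpha> * of_nat (\<nu> i)) * exp (\<i> * complex_of_real \<alpha> * of_nat (\<nu> j))
          = exp (- \<i> * complex_of_real \<alpha> * of_int q)"
        by (simp flip: exp_add add: algebra_simps)
      then show ?thesis unfolding L using X ij by (simp add: mult_ac)
    qed
  qed (use X L in auto)
qed

section \<open>Matrix entries of the ladder operators; the number operator of a mode\<close>

lemma unset_bit_less_two_power: "b < 2 ^ n \<Longrightarrow> unset_bit p b < 2 ^ n" for b :: nat
  using unset_bit_less_eq[of p "int b"] by (simp flip: of_nat_unset_bit_eq)

text \<open>Numbers below \<open>2 ^ n\<close> are the fixed points of \<open>take_bit n\<close>,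
  which commutes with setting a bit at a position below \<open>n\<close>.\<close>

lemma set_bit_less_two_power: "p < n \<Longrightarrow> b < 2 ^ n \<Longrightarrow> set_bit p b < 2 ^ n" for b :: nat
  by (metis take_bit_nat_eq_self_iff take_bit_set_bit_eq not_le)

lemma annihilation_carrier: "annihilation ks k \<sigma> \<in> carrier_mat (fock_dim ks) (fock_dim ks)"
  by (auto simp: annihilation_def Let_def)

lemma creation_carrier: "creation ks k \<sigma> \<in> carrier_mat (fock_dim ks) (fock_dim ks)"
  by (auto simp: creation_def Let_def)

lemma annihilation_index:
  assumes "i < fock_dim ks" and "j < fock_dim ks"
  shows "annihilation ks k \<sigma> $$ (i, j) =
    (if bit j (mode_pos ks k \<sigma>) \<and> i = unset_bit (mode_pos ks k \<sigma>) j
     then (-1) ^ left_occupation (mode_pos ks k \<sigma>) j else 0)"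
  using assms unset_bit_less_two_power[of j "2 * length ks"]
  by (auto simp: annihilation_def Let_def mat_of_cols_index fock_dim_def)

lemma creation_index:
  assumes "k \<in> set ks" and "i < fock_dim ks" and "j < fock_dim ks"
  shows "creation ks k \<sigma> $$ (i, j) =
    (if \<not> bit j (mode_pos ks k \<sigma>) \<and> i = set_bit (mode_pos ks k \<sigma>) j
     then (-1) ^ left_occupation (mode_pos ks k \<sigma>) j else 0)"
  using assms set_bit_less_two_power[OF mode_pos_less[OF assms(1)], of j]
  by (auto simp: creation_def Let_def mat_of_cols_index fock_dim_def)

text \<open>Only positions strictly below \<open>p\<close> are counted. Hence creation and
  annihilation of the same mode carry equal signs, which cancel in their product.\<close>

lemma left_occupation_unset_bit: "left_occupation p (unset_bit p b) = left_occupation p b"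
  unfolding left_occupation_def by (intro sum.cong) (auto simp: bit_simps)

lemma creation_annihilation:
  assumes "k \<in> set ks"
  shows "creation ks k \<sigma> * annihilation ks k \<sigma> =
    mat_diag (fock_dim ks) (\<lambda>b. of_nat (of_bool (bit b (mode_pos ks k \<sigma>))))"
proof (rule eq_matI)
  define N where "N = fock_dim ks"
  define p where "p = mode_pos ks k \<sigma>"
  note C = creation_carrier[of ks k \<sigma>, folded N_def]
  note A = annihilation_carrier[of ks k \<sigma>, folded N_def]
  fix i j
  assume "i < dim_row (mat_diag (fock_dim ks) (\<lambda>b. of_nat (of_bool (bit b (mode_pos ks k \<sigma>))) :: complex))"
    "j < dim_col (mat_diag (fock_dim ks) (\<lambda>b. of_nat (of_bool (bit b (mode_pos ks k \<sigma>))) :: complex))"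
  then have ij: "i < N" "j < N" by (simp_all add: mat_diag_def N_def)
  have u: "unset_bit p j < N"
    using ij(2) by (simp add: N_def fock_dim_def unset_bit_less_two_power)
  have set_unset: "set_bit p (unset_bit p j) = j" if "bit j p"
    using that by (auto intro!: bit_eqI simp: bit_simps)
  have "(creation ks k \<sigma> * annihilation ks k \<sigma>) $$ (i, j)
      = (\<Sum>l<N. creation ks k \<sigma> $$ (i, l) * annihilation ks k \<sigma> $$ (l, j))"
    using C A ij by (simp add: scalar_prod_def atLeast0LessThan)
  \<comment> \<open>Column \<open>j\<close> of the annihilation operator has at most one nonzero
    entry, in row \<open>unset_bit p j\<close>.\<close>
  also have "\<dots> = (\<Sum>l<N. if l = unset_bit p j
      then creation ks k \<sigma> $$ (i, l) * of_bool (bit j p) * (-1) ^ left_occupation p j else 0)"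
    using ij by (intro sum.cong) (auto simp: annihilation_index N_def p_def)
  also have "\<dots> = creation ks k \<sigma> $$ (i, unset_bit p j) * of_bool (bit j p) * (-1) ^ left_occupation p j"
    using u by simp
  \<comment> \<open>Creation restores the cleared bit, and the product of the two equal signs is
    1.\<close>
  also have "\<dots> = of_bool (i = j \<and> bit j p)"
    using ij u assms set_unset
    by (auto simp: creation_index N_def[symmetric] p_def[symmetric] left_occupation_unset_bit bit_simps
        simp flip: power_add mult_2)
  finally show "(creation ks k \<sigma> * annihilation ks k \<sigma>) $$ (i, j) =
      mat_diag (fock_dim ks) (\<lambda>b. of_nat (of_bool (bit b (mode_pos ks k \<sigma>)))) $$ (i, j)"
    using ij by (simp add: mat_diag_def N_def p_def)
qed (use creation_carrier[of ks k \<sigma>] annihilation_carrier[of ks k \<sigma>] in \<open>auto simp: mat_diag_def\<close>)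

section \<open>The number of occupied modes and its change under a bit flip\<close>

text \<open>The sum runs over modes instead of bit positions, so that it matches the sum in
  \<open>number_op\<close> term by term.\<close>

definition occupation :: "(real ^ 3) list \<Rightarrow> nat \<Rightarrow> nat" where
  "occupation ks b = (\<Sum>(k, \<sigma>)\<in>set ks \<times> {Up, Down}. of_bool (bit b (mode_pos ks k \<sigma>)))"

lemma number_op_diag: "number_op ks = mat_diag (fock_dim ks) (\<lambda>b. of_nat (occupation ks b))"
  unfolding number_op_def
  by (subst op_sum_mat_diag[where g = "\<lambda>(k, \<sigma>) b. of_nat (of_bool (bit b (mode_pos ks k \<sigma>)))"])
    (auto simp: creation_annihilation occupation_def case_prod_unfold intro!: arg_cong[of _ _ "mat_diag _"])

text \<open>The parity of the position determines the spin, and its half is the index at which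
  \<open>takeWhile\<close> stops, where the list holds the momentum itself.\<close>

lemma mode_pos_inject:
  assumes "k \<in> set ks" and "k' \<in> set ks" and "mode_pos ks k \<sigma> = mode_pos ks k' \<sigma>'"
  shows "k = k' \<and> \<sigma> = \<sigma>'"
proof -
  have nth: "ks ! length (takeWhile (\<lambda>q. q \<noteq> x) ks) = x" if "x \<in> set ks" for x
  proof -
    have "length (takeWhile (\<lambda>q. q \<noteq> x) ks) < length ks"
      using mode_pos_less[OF that, of Up] by (simp add: mode_pos_def)
    then show ?thesis using nth_length_takeWhile by fastforce
  qed
  have "length (takeWhile (\<lambda>q. q \<noteq> k) ks) = length (takeWhile (\<lambda>q. q \<noteq> k') ks) \<and> \<sigma> = \<sigma>'"
    using assms(3) unfolding mode_pos_def by (cases \<sigma>; cases \<sigma>') (simp; presburger)+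
  then show ?thesis using nth[OF assms(1)] nth[OF assms(2)] by metis
qed

lemma occupation_remove:
  assumes "k \<in> set ks"
  shows "occupation ks b = of_bool (bit b (mode_pos ks k \<sigma>)) +
    (\<Sum>(k', \<sigma>')\<in>set ks \<times> {Up, Down} - {(k, \<sigma>)}. of_bool (bit b (mode_pos ks k' \<sigma>')))"
proof -
  have "(k, \<sigma>) \<in> set ks \<times> {Up, Down}" using assms by (cases \<sigma>) auto
  then show ?thesis unfolding occupation_def by (subst sum.remove[of _ "(k, \<sigma>)"]) simp_all
qed

text \<open>By \<open>mode_pos_inject\<close> every other mode reads a position different from that
  of \<open>(k, \<sigma>)\<close>, and there \<open>b\<close> and \<open>c\<close> agree. A bit flip
  therefore changes only the term split off by \<open>occupation_remove\<close>.\<close>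

lemma occupation_cong_remove:
  assumes "k \<in> set ks" and "\<And>q. q \<noteq> mode_pos ks k \<sigma> \<Longrightarrow> bit b q = bit c q"
  shows "(\<Sum>(k', \<sigma>')\<in>set ks \<times> {Up, Down} - {(k, \<sigma>)}. of_bool (bit b (mode_pos ks k' \<sigma>')))
    = (\<Sum>(k', \<sigma>')\<in>set ks \<times> {Up, Down} - {(k, \<sigma>)}. of_bool (bit c (mode_pos ks k' \<sigma>')) :: nat)"
proof (rule sum.cong[OF refl])
  fix x assume "x \<in> set ks \<times> {Up, Down} - {(k, \<sigma>)}"
  then obtain k' \<sigma>' where x: "x = (k', \<sigma>')" and "k' \<in> set ks" "(k', \<sigma>') \<noteq> (k, \<sigma>)" by blast
  then have "mode_pos ks k' \<sigma>' \<noteq> mode_pos ks k \<sigma>"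
    using mode_pos_inject[OF _ assms(1)] by blast
  then show "(\<lambda>(k', \<sigma>'). of_bool (bit b (mode_pos ks k' \<sigma>'))) x
      = ((\<lambda>(k', \<sigma>'). of_bool (bit c (mode_pos ks k' \<sigma>'))) x :: nat)"
    using assms(2) x by simp
qed

lemma occupation_unset_bit:
  assumes "k \<in> set ks" and "bit b (mode_pos ks k \<sigma>)"
  shows "occupation ks b = Suc (occupation ks (unset_bit (mode_pos ks k \<sigma>) b))"
proof -
  note remove = occupation_remove[OF assms(1), where \<sigma> = \<sigma>]
  show ?thesis
    unfolding remove[of b] remove[of "unset_bit _ b"]
    using assms occupation_cong_remove[OF assms(1), of \<sigma> b "unset_bit (mode_pos ks k \<sigma>) b"]
    by (simp add: bit_simps)
qed

lemma occupation_set_bit: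
  assumes "k \<in> set ks" and "\<not> bit b (mode_pos ks k \<sigma>)"
  shows "occupation ks (set_bit (mode_pos ks k \<sigma>) b) = Suc (occupation ks b)"
proof -
  note remove = occupation_remove[OF assms(1), where \<sigma> = \<sigma>]
  show ?thesis
    unfolding remove[of b] remove[of "set_bit _ b"]
    using assms occupation_cong_remove[OF assms(1), of \<sigma> b "set_bit (mode_pos ks k \<sigma>) b"]
    by (simp add: bit_simps)
qed

section \<open>Degrees of the ladder operators and of the Hamiltonian\<close>

lemma homogeneous_annihilation:
  assumes "k \<in> set ks"
  shows "homogeneous (fock_dim ks) (occupation ks) (-1) (annihilation ks k \<sigma>)"
  unfolding homogeneous_def
  using annihilation_carrier assms
  by (auto simp: annihilation_index occupation_unset_bit split: if_splits)

lemma homogeneous_creation: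
  assumes "k \<in> set ks"
  shows "homogeneous (fock_dim ks) (occupation ks) 1 (creation ks k \<sigma>)"
  unfolding homogeneous_def
  using creation_carrier assms
  by (auto simp: creation_index occupation_set_bit split: if_splits)

text \<open>Each interaction term creates two particles and annihilates two. Closure under negation
  puts the modes of \<open>- k\<close> and \<open>- k'\<close> into the list, where the degrees of
  their operators are known.\<close>

lemma homogeneous_bcs_hamiltonian:
  assumes "\<And>k. k \<in> set ks \<Longrightarrow> - k \<in> set ks"
  shows "homogeneous (fock_dim ks) (occupation ks) 0 (bcs_hamiltonian ks hbar m \<mu> U)"
proof -
  note hom = homogeneous_annihilation homogeneous_creation
  have one_body: "homogeneous (fock_dim ks) (occupation ks) 0 (creation ks k \<sigma> * annihilation ks k \<sigma>)"
    if "k \<in> set ks" for k \<sigma>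
    using homogeneous_mult[OF hom(2)[OF that] hom(1)[OF that]] by simp
  have two_body: "homogeneous (fock_dim ks) (occupation ks) 0 (creation ks k' Up
      * creation ks (- k') Down * annihilation ks (- k) Down * annihilation ks k Up)"
    if "k \<in> set ks" "k' \<in> set ks" for k k'
    using homogeneous_mult[OF homogeneous_mult[OF homogeneous_mult[OF hom(2) hom(2)] hom(1)] hom(1)]
      that assms by fastforce
  show ?thesis
    unfolding bcs_hamiltonian_def
    by (intro homogeneous_add homogeneous_op_sum)
      (auto intro!: homogeneous_smult one_body two_body)
qed

text \<open>Negating the three integers leaves the cutoff unchanged, since it involves only their
  squares. This supplies the closure under negation for the Hamiltonian.\<close>

lemma uminus_momenta:
  assumes "k \<in> momenta L Kmax"
  shows "- k \<in> momenta L Kmax"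
proof -
  obtain n1 n2 n3 where k: "k = (2 * pi / L) *\<^sub>R vector [real_of_int n1, real_of_int n2, real_of_int n3]"
    and le: "2 * pi / L * sqrt ((real_of_int n1)\<^sup>2 + (real_of_int n2)\<^sup>2 + (real_of_int n3)\<^sup>2) \<le> Kmax"
    using assms unfolding momenta_def by blast
  have "- k = (2 * pi / L) *\<^sub>R vector [real_of_int (- n1), real_of_int (- n2), real_of_int (- n3)]"
    by (simp add: k Finite_Cartesian_Product.vec_eq_iff forall_3)
  moreover have "2 * pi / L * sqrt ((real_of_int (- n1))\<^sup>2 + (real_of_int (- n2))\<^sup>2 + (real_of_int (- n3))\<^sup>2) \<le> Kmax"
    using le by simp
  ultimately show ?thesis unfolding momenta_def by blast
qed

theorem proposition2p7:
  fixes L Kmax hbar m \<mu> :: real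
    and ks :: "(real ^ 3) list"
    and U :: "real ^ 3 \<Rightarrow> real ^ 3 \<Rightarrow> real"
  defines "\<Lambda> \<equiv> momenta L Kmax"
    and "G \<equiv> number_op ks"
    and "H \<equiv> bcs_hamiltonian ks hbar m \<mu> U"
  assumes "L > 0" and "Kmax > 0"
    and "distinct ks" and "set ks = \<Lambda>"
    and "m > 0" and "\<mu> > 0" and "hbar > 0"
    and "\<And>k k'. k \<in> \<Lambda> \<Longrightarrow> k' \<in> \<Lambda> \<Longrightarrow> U k k' \<le> 0"
    and "\<And>k k'. k \<in> \<Lambda> \<Longrightarrow> k' \<in> \<Lambda> \<Longrightarrow> U k' k = U k k'"
    and "\<And>k k'. k \<in> \<Lambda> \<Longrightarrow> k' \<in> \<Lambda> \<Longrightarrow> U (- k) (- k') = U k k'"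
    and "\<And>k. k \<in> \<Lambda> \<Longrightarrow> U k k = 0"
  shows "(\<forall>\<alpha>::real. \<forall>k\<in>\<Lambda>. \<forall>\<sigma>.
      exp_mat ((- \<i> * complex_of_real \<alpha>) \<cdot>\<^sub>m G) * annihilation ks k \<sigma>
          * exp_mat ((\<i> * complex_of_real \<alpha>) \<cdot>\<^sub>m G)
        = exp (\<i> * complex_of_real \<alpha>) \<cdot>\<^sub>m annihilation ks k \<sigma>
      \<and> exp_mat ((- \<i> * complex_of_real \<alpha>) \<cdot>\<^sub>m G) * creation ks k \<sigma>
          * exp_mat ((\<i> * complex_of_real \<alpha>) \<cdot>\<^sub>m G)
        = exp (- \<i> * complex_of_real \<alpha>) \<cdot>\<^sub>m creation ks k \<sigma>)
    \<and> (\<forall>\<alpha>::real.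
      exp_mat ((- \<i> * complex_of_real \<alpha>) \<cdot>\<^sub>m G) * H
          * exp_mat ((\<i> * complex_of_real \<alpha>) \<cdot>\<^sub>m G) = H)"
proof -
  have ks: "set ks = \<Lambda>" by fact
  have \<Lambda>: "- k \<in> \<Lambda>" if "k \<in> \<Lambda>" for k
    using uminus_momenta that unfolding \<Lambda>_def by simp
  \<comment> \<open>Folding turns the diagonal matrix into \<open>G\<close>. The degrees -1, 1 and 0
    then give the factors \<open>exp (\<i> * \<alpha>)\<close>,
    \<open>exp (- \<i> * \<alpha>)\<close> and 1.\<close>
  note conj = homogeneous_conjugation[of "fock_dim ks" "occupation ks", folded number_op_diag G_def]
  have H: "homogeneous (fock_dim ks) (occupation ks) 0 H"
    unfolding H_def using homogeneous_bcs_hamiltonian ks \<Lambda> by blast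
  have "1 \<cdot>\<^sub>m H = H" by (rule eq_matI) simp_all
  then show ?thesis
    using conj[OF homogeneous_annihilation] conj[OF homogeneous_creation] conj[OF H] ks
    by simp
qed

end
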